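(* There is a pair of convex polygons $(P_-,P_+)$ in $\mathbb{R}^2$ for which the symplectic billiard map has no periodic orbits at all, i.e. there is no $(x_0,x_1)$ in the phase space $\mathcal{P}$ of $(P_-,P_+)$ and no integer $n\ge1$ with $\phi^n(x_0,x_1)=(x_0,x_1)$.
   Context: A convex polygon $P$ is the closed polygonal boundary curve of a bounded convex region in $\mathbb{R}^2$ with finite vertex set $V$, no three consecutive vertices collinear; its edges are the open segments between consecutive vertices and $\mathrm{int}(P)$ is the bounded component of $\mathbb{R}^2\setminus P$. For $y\in P\setminus V$, $T_yP\subset\mathbb{R}^2$ is the linear line parallel to the edge containing $y$. For points $a,b$, $ab$ is the open segment between them. Let $(P_-,P_+)$ be a pair of polygons with vertex sets $V_-,V_+$. The notation $P_\pm,P_\mp$ indicates a choice of sign and its opposite. A pair $(x,y)\in P_\pm\times P_\mp$ satisfies condition A if $y\notin V_\mp$ and there is exactly one $z\in P_\pm\cap\{x+t: t\in T_yP_\mp, t\neq 0\}$ with $xz\subset\mathrm{int}(P_\pm)$. Let $\mathcal{P}_{\max}$ be the set of $(x,y)\in(P_-\times P_+)\sqcup(P_+\times P_-)$ satisfying condition A. The symplectic billiard map is $\phi:\mathcal{P}_{\max}\to(P_-\times P_+)\sqcup(P_+\times P_-)$, $\phi(x,y)=(y,z)$ with this $z$. Let $\sigma(x,y)=(y,x)$, $N_0=(P_-\times V_+)\sqcup(P_+\times V_-)$, $N_{i+1}=\phi^{-1}(N_i)$ (preimage) for $i\ge 0$, and $N=\bigcup_{i\ge0}N_i\cup\sigma(\bigcup_{i\ge0}N_i)$.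 The phase space is $\mathcal{P}=\mathcal{P}_{\max}\setminus N$; it is the complement of a null set in $\mathcal{P}_{\max}$ and $\phi$ restricts to a bijection of $\mathcal{P}$. *)

theory Defs
  imports "HOL-Analysis.Analysis"
begin

text \<open>A convex polygon is given by the list of its vertices in cyclic order; both orientations and
  any starting vertex are allowed.\<close>

definition vert :: "(real^2) list \<Rightarrow> nat \<Rightarrow> real^2" where
  "vert vs i = vs ! (i mod length vs)"

definition polygon_curve :: "(real^2) list \<Rightarrow> (real^2) set" where
  "polygon_curve vs = (\<Union>i<length vs. closed_segment (vert vs i) (vert vs (Suc i)))"

text \<open>Distinctness makes the list run through the boundary curve exactly once.\<close>

definition convex_polygon :: "(real^2) list \<Rightarrow> bool" where
  "convex_polygon vs \<longleftrightarrow>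
     length vs \<ge> 3 \<and> distinct vs \<and>
     (\<forall>i. \<not> collinear {vert vs i, vert vs (Suc i), vert vs (Suc (Suc i))}) \<and>
     (\<exists>C. open C \<and> C \<noteq> {} \<and> convex C \<and> bounded C \<and> polygon_curve vs = frontier C)"

text \<open>For \<open>y\<close> on an edge this is the linear line parallel to that edge; it is empty if \<open>y\<close> lies
  on no edge, in particular if \<open>y\<close> is a vertex.\<close>

definition tangent_line :: "(real^2) list \<Rightarrow> real^2 \<Rightarrow> (real^2) set" where
  "tangent_line vs y =
     (\<Union>i\<in>{i. i < length vs \<and> y \<in> open_segment (vert vs i) (vert vs (Suc i))}.
        span {vert vs (Suc i) - vert vs i})"

datatype sign = Minus | Plus

fun opp :: "sign \<Rightarrow> sign" where
  "opp Minus = Plus"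
| "opp Plus = Minus"

text \<open>A pair of polygons is a family \<open>Q\<close> indexed by signs. The disjoint union of
  \<open>P\<^sub>- \<times> P\<^sub>+\<close> and \<open>P\<^sub>+ \<times> P\<^sub>-\<close> consists of the triples \<open>(s, x, y)\<close> where the tag \<open>s\<close> is the sign
  of the polygon containing \<open>x\<close>, so \<open>y\<close> lies on the polygon of sign \<open>opp s\<close>.\<close>

type_synonym polygon_pair = "sign \<Rightarrow> (real^2) list"
type_synonym state = "sign \<times> (real^2) \<times> (real^2)"

definition states :: "polygon_pair \<Rightarrow> state set" where
  "states Q = {(s, x, y). x \<in> polygon_curve (Q s) \<and> y \<in> polygon_curve (Q (opp s))}"

definition is_successor :: "polygon_pair \<Rightarrow> state \<Rightarrow> real^2 \<Rightarrow> bool" where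
  "is_successor Q = (\<lambda>(s, x, y) z.
     z \<in> polygon_curve (Q s) \<inter> {x + t | t. t \<in> tangent_line (Q (opp s)) y \<and> t \<noteq> 0} \<and>
     open_segment x z \<subseteq> inside (polygon_curve (Q s)))"

definition condition_A :: "polygon_pair \<Rightarrow> state \<Rightarrow> bool" where
  "condition_A Q = (\<lambda>(s, x, y). y \<notin> set (Q (opp s)) \<and> (\<exists>!z. is_successor Q (s, x, y) z))"

definition P_max :: "polygon_pair \<Rightarrow> state set" where
  "P_max Q = {p \<in> states Q. condition_A Q p}"

text \<open>The map is meaningful on \<open>P_max Q\<close> only; outside it its value is unspecified.\<close>

definition billiard_map :: "polygon_pair \<Rightarrow> state \<Rightarrow> state" where
  "billiard_map Q = (\<lambda>(s, x, y). (opp s, y, THE z. is_successor Q (s, x, y) z))"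

fun swap_state :: "state \<Rightarrow> state" where
  "swap_state (s, x, y) = (opp s, y, x)"

text \<open>Preimages are taken under the map with domain \<open>P_max Q\<close>.\<close>

fun singular :: "polygon_pair \<Rightarrow> nat \<Rightarrow> state set" where
  "singular Q 0 = {(s, x, y). x \<in> polygon_curve (Q s) \<and> y \<in> set (Q (opp s))}"
| "singular Q (Suc i) = {p \<in> P_max Q. billiard_map Q p \<in> singular Q i}"

definition singular_set :: "polygon_pair \<Rightarrow> state set" where
  "singular_set Q = (\<Union>i. singular Q i) \<union> swap_state ` (\<Union>i. singular Q i)"

text \<open>The map sends this set into itself, so its iterates never involve unspecified values there.\<close>

definition phase_space :: "polygon_pair \<Rightarrow> state set" where
  "phase_space Q = P_max Q - singular_set Q"

end

theory Submission
  imports Defs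
begin

text \<open>Take the rectangle \<open>[0, 1] \<times> [0, b]\<close> with \<open>b\<close> irrational and the triangle with vertices
  \<open>(0, 0)\<close>, \<open>(1, 0)\<close>, \<open>(0, 1)\<close>. Every orbit reaches a state \<open>(x, y)\<close> with \<open>x\<close> on the rectangle
  and \<open>y\<close> on the hypotenuse. From there \<open>x\<close> first moves along a chord of slope \<open>-1\<close>, which
  preserves the sum \<open>s\<close> of its coordinates; then \<open>y\<close> goes to a leg and comes back to the same
  point of the hypotenuse after \<open>x\<close> has jumped horizontally or vertically to the opposite side.
  Chord and jump both interchange the bottom and right sides with the left and top sides.
  Hence over four steps \<open>s\<close> changes by \<open>1\<close> or \<open>-b\<close> if \<open>x\<close> starts on the bottom or right side,
  and by \<open>b\<close> or \<open>-1\<close> otherwise: modulo \<open>1 + b\<close> this is an irrational rotation.\<close>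

section \<open>Coordinates and axis-parallel segments in the plane\<close>

abbreviation pt :: "real \<Rightarrow> real \<Rightarrow> real^2" where
  "pt p q \<equiv> vector [p, q]"

lemma pt_eq_iff [simp]: "pt p q = pt r s \<longleftrightarrow> p = r \<and> q = s"
  by (auto simp: vec_eq_iff forall_2)

lemma pt_arith [simp]:
  "pt p q + pt r s = pt (p + r) (q + s)"
  "pt p q - pt r s = pt (p - r) (q - s)"
  "c *\<^sub>R pt p q = pt (c * p) (c * q)"
  by (simp_all add: vec_eq_iff forall_2)

lemma pt_eq_0_iff [simp]: "pt p q = 0 \<longleftrightarrow> p = 0 \<and> q = 0"
  by (auto simp: vec_eq_iff forall_2)

lemma pt_exhaust: obtains p q where "x = pt p q"
proof -
  have "x = pt (x $ 1) (x $ 2)" by (simp add: vec_eq_iff forall_2)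
  then show thesis using that by blast
qed

lemma closed_segment_pt_horizontal:
  assumes "a < c"
  shows "pt p q \<in> closed_segment (pt a b) (pt c b) \<longleftrightarrow> q = b \<and> a \<le> p \<and> p \<le> c"
proof
  assume "pt p q \<in> closed_segment (pt a b) (pt c b)"
  then obtain u where "0 \<le> u" "u \<le> 1" "p = (1 - u) * a + u * c" "q = (1 - u) * b + u * b"
    by (auto simp: in_segment)
  moreover from this have "p = a + u * (c - a)" "p = c - (1 - u) * (c - a)" "q = b"
    by (auto simp: algebra_simps)
  moreover have "0 \<le> u * (c - a)" "0 \<le> (1 - u) * (c - a)"
    using assms \<open>0 \<le> u\<close> \<open>u \<le> 1\<close> by (auto intro!: mult_nonneg_nonneg)
  ultimately show "q = b \<and> a \<le> p \<and> p \<le> c"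
    by linarith
next
  assume "q = b \<and> a \<le> p \<and> p \<le> c"
  then show "pt p q \<in> closed_segment (pt a b) (pt c b)"
    using assms unfolding in_segment
    by (intro exI[of _ "(p - a) / (c - a)"]) (auto simp: divide_simps, auto simp: algebra_simps)
qed

text \<open>Reflection in the main diagonal, so that vertical segments reduce to horizontal
  ones.\<close>

lemma closed_segment_pt_swap:
  "pt p q \<in> closed_segment (pt a b) (pt c d) \<longleftrightarrow> pt q p \<in> closed_segment (pt b a) (pt d c)"
  by (auto simp: in_segment)

lemma closed_segment_pt_vertical:
  assumes "b < d"
  shows "pt p q \<in> closed_segment (pt a b) (pt a d) \<longleftrightarrow> p = a \<and> b \<le> q \<and> q \<le> d"
  using closed_segment_pt_horizontal[OF assms] by (subst closed_segment_pt_swap)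

lemma closed_segment_pt_diagonal:
  "pt p q \<in> closed_segment (pt 1 0) (pt 0 1) \<longleftrightarrow> p + q = 1 \<and> 0 \<le> q \<and> q \<le> 1"
  by (auto simp: in_segment)

lemmas closed_segment_pt =
  closed_segment_pt_horizontal closed_segment_pt_vertical closed_segment_pt_diagonal

lemma open_segment_pt:
  "a < c \<Longrightarrow> pt p q \<in> open_segment (pt a b) (pt c b) \<longleftrightarrow> q = b \<and> a < p \<and> p < c"
  "b < d \<Longrightarrow> pt p q \<in> open_segment (pt a b) (pt a d) \<longleftrightarrow> p = a \<and> b < q \<and> q < d"
  "pt p q \<in> open_segment (pt 1 0) (pt 0 1) \<longleftrightarrow> p + q = 1 \<and> 0 < q \<and> q < 1"
  by (auto simp: open_segment_def closed_segment_pt)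

section \<open>The rectangle and the triangle as boundaries of open convex regions\<close>

definition rect :: "real \<Rightarrow> (real^2) list" where
  "rect b = [pt 0 0, pt 1 0, pt 1 b, pt 0 b]"

definition tri :: "(real^2) list" where
  "tri = [pt 0 0, pt 1 0, pt 0 1]"

definition rect_interior :: "real \<Rightarrow> (real^2) set" where
  "rect_interior b = {x. 0 < x$1 \<and> x$1 < 1 \<and> 0 < x$2 \<and> x$2 < b}"

definition tri_interior :: "(real^2) set" where
  "tri_interior = {x. 0 < x$1 \<and> 0 < x$2 \<and> x$1 + x$2 < 1}"

text \<open>A convex set with nonempty interior has the same closure as its interior, so the
  boundary curve can be read off from non-strict and strict inequalities.\<close>

lemma frontier_interior_convex:
  fixes T :: "'a::euclidean_space set"
  assumes "convex T" "closed T" "interior T \<noteq> {}"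
  shows "frontier (interior T) = T - interior T"
  using assms by (simp add: frontier_def convex_closure_interior)

lemma rect_interior_props:
  assumes "b > 0"
  shows "open (rect_interior b)" "rect_interior b \<noteq> {}" "convex (rect_interior b)"
    "bounded (rect_interior b)"
    "frontier (rect_interior b) = {x. 0 \<le> x$1 \<and> x$1 \<le> 1 \<and> 0 \<le> x$2 \<and> x$2 \<le> b} - rect_interior b"
proof -
  \<comment> \<open>As an intersection of half-planes this set has an evident interior; as a box it
    is evidently convex, closed and bounded.\<close>
  let ?T = "{x::real^2. x$1 \<ge> 0} \<inter> {x. x$1 \<le> 1} \<inter> {x. x$2 \<ge> 0} \<inter> {x. x$2 \<le> b}"
  have T: "?T = {x. 0 \<le> x$1 \<and> x$1 \<le> 1 \<and> 0 \<le> x$2 \<and> x$2 \<le> b}" by auto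
  have box: "?T = cbox (pt 0 0) (pt 1 b)"
    by (auto simp: mem_box_cart forall_2)
  have int: "rect_interior b = interior ?T"
    by (auto simp: rect_interior_def)
  show "open (rect_interior b)" by (simp only: int open_interior)
  have "pt (1/2) (b/2) \<in> rect_interior b" using assms by (simp add: rect_interior_def)
  then show ne: "rect_interior b \<noteq> {}" by blast
  show "convex (rect_interior b)"
    unfolding int box by (intro convex_interior convex_box)
  show "bounded (rect_interior b)"
    unfolding int box by (intro bounded_interior bounded_cbox)
  show "frontier (rect_interior b) = {x. 0 \<le> x$1 \<and> x$1 \<le> 1 \<and> 0 \<le> x$2 \<and> x$2 \<le> b} - rect_interior b"
    using frontier_interior_convex[of ?T] ne unfolding T[symmetric] int box
    by (simp add: convex_box closed_cbox)
qed

lemma tri_interior_props: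
  shows "open tri_interior" "tri_interior \<noteq> {}" "convex tri_interior" "bounded tri_interior"
    "frontier tri_interior = {x. 0 \<le> x$1 \<and> 0 \<le> x$2 \<and> x$1 + x$2 \<le> 1} - tri_interior"
proof -
  \<comment> \<open>Writing the sides with inner products makes convexity, closedness and the
    interior instances of the facts on half-spaces.\<close>
  let ?T = "{x. pt 1 0 \<bullet> x \<ge> 0} \<inter> {x. pt 0 1 \<bullet> x \<ge> 0} \<inter> {x. pt 1 1 \<bullet> x \<le> 1}"
  have T: "?T = {x. 0 \<le> x$1 \<and> 0 \<le> x$2 \<and> x$1 + x$2 \<le> 1}"
    by (auto simp: inner_vec_def sum_2)
  have "interior ?T = {x. pt 1 0 \<bullet> x > 0} \<inter> {x. pt 0 1 \<bullet> x > 0} \<inter> {x. pt 1 1 \<bullet> x < 1}"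
    by simp
  then have int: "tri_interior = interior ?T"
    by (simp only:) (auto simp: tri_interior_def inner_vec_def sum_2)
  have conv: "convex ?T"
    by (intro convex_Int convex_halfspace_ge convex_halfspace_le)
  have clo: "closed ?T"
    by (intro closed_Int closed_halfspace_ge closed_halfspace_le)
  show "open tri_interior" by (simp only: int open_interior)
  have "pt (1/3) (1/3) \<in> tri_interior" by (simp add: tri_interior_def)
  then show ne: "tri_interior \<noteq> {}" by blast
  show "convex tri_interior"
    unfolding int by (intro convex_interior conv)
  have "tri_interior \<subseteq> rect_interior 1" by (auto simp: tri_interior_def rect_interior_def)
  then show "bounded tri_interior"
    using bounded_subset rect_interior_props(4)[of 1] by auto
  show "frontier tri_interior = {x. 0 \<le> x$1 \<and> 0 \<le> x$2 \<and> x$1 + x$2 \<le> 1} - tri_interior"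
    using frontier_interior_convex[OF conv clo] ne unfolding T[symmetric] int by simp
qed

lemma vert_simps:
  "vert (rect b) 0 = pt 0 0" "vert (rect b) 1 = pt 1 0" "vert (rect b) 2 = pt 1 b"
  "vert (rect b) 3 = pt 0 b" "vert (rect b) 4 = pt 0 0"
  "vert tri 0 = pt 0 0" "vert tri 1 = pt 1 0" "vert tri 2 = pt 0 1" "vert tri 3 = pt 0 0"
  "vert tri (Suc 0) = pt 1 0" "vert (rect b) (Suc 0) = pt 1 0"
  "vert tri (Suc (Suc 0)) = pt 0 1" "vert (rect b) (Suc (Suc 0)) = pt 1 b"
  by (simp_all add: vert_def rect_def tri_def)

lemma lessThan_length:
  "{..<length (rect b)} = {0, 1, 2, 3}" "{..<length tri} = {0, 1, 2}"
  by (auto simp: rect_def tri_def)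

lemma polygon_curve_rect_iff:
  assumes "b > 0"
  shows "pt p q \<in> polygon_curve (rect b) \<longleftrightarrow>
    0 \<le> p \<and> p \<le> 1 \<and> 0 \<le> q \<and> q \<le> b \<and> (p = 0 \<or> p = 1 \<or> q = 0 \<or> q = b)"
  using assms unfolding polygon_curve_def lessThan_length
  by (auto simp: vert_simps closed_segment_pt closed_segment_commute[of "pt 1 b" "pt 0 b"]
      closed_segment_commute[of "pt 0 b" "pt 0 0"])

lemma polygon_curve_tri_iff:
  "pt p q \<in> polygon_curve tri \<longleftrightarrow>
    0 \<le> p \<and> 0 \<le> q \<and> p + q \<le> 1 \<and> (p = 0 \<or> q = 0 \<or> p + q = 1)"
  unfolding polygon_curve_def lessThan_length
  by (auto simp: vert_simps closed_segment_pt closed_segment_commute[of "pt 0 1" "pt 0 0"])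

lemma polygon_curve_rect:
  assumes "b > 0"
  shows "polygon_curve (rect b) = frontier (rect_interior b)"
proof (rule set_eqI)
  fix x show "x \<in> polygon_curve (rect b) \<longleftrightarrow> x \<in> frontier (rect_interior b)"
    using assms by (cases x rule: pt_exhaust)
      (auto simp: polygon_curve_rect_iff rect_interior_props(5), auto simp: rect_interior_def)
qed

lemma polygon_curve_tri: "polygon_curve tri = frontier tri_interior"
proof (rule set_eqI)
  fix x show "x \<in> polygon_curve tri \<longleftrightarrow> x \<in> frontier tri_interior"
    by (cases x rule: pt_exhaust)
      (auto simp: polygon_curve_tri_iff tri_interior_props(5), auto simp: tri_interior_def)
qed

text \<open>The hypothesis says that the determinant of the two difference vectors based at
  \<open>pt a b\<close> does not vanish.\<close>

lemma not_collinear_pt: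
  assumes "(c - a) * (f - b) \<noteq> (e - a) * (d - b)"
  shows "\<not> collinear {pt a b, pt c d, pt e f}"
proof
  assume "collinear {pt a b, pt c d, pt e f}"
  then consider "pt a b = pt e f" | u where "pt c d = u *\<^sub>R pt a b + (1 - u) *\<^sub>R pt e f"
    unfolding collinear_3_expand by blast
  then show False
  proof cases
    case 2
    then have "c - a = (1 - u) * (e - a)" "d - b = (1 - u) * (f - b)"
      by (auto simp: algebra_simps)
    then show False using assms by simp
  qed (use assms in auto)
qed

lemma convex_polygon_rect:
  assumes "b > 0"
  shows "convex_polygon (rect b)"
proof -
  have "\<not> collinear {vert (rect b) i, vert (rect b) (Suc i), vert (rect b) (Suc (Suc i))}" for i
  proof -
    \<comment> \<open>\<open>vert\<close> depends only on the index modulo the length, so one check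
      per corner suffices.\<close>
    have "i mod 4 < 4" by simp
    then consider "i mod 4 = 0" | "i mod 4 = 1" | "i mod 4 = 2" | "i mod 4 = 3" by linarith
    then show ?thesis
      using assms by cases (auto simp: vert_def rect_def mod_Suc intro!: not_collinear_pt)
  qed
  moreover have "distinct (rect b)" "length (rect b) \<ge> 3" using assms by (auto simp: rect_def)
  ultimately show ?thesis
    unfolding convex_polygon_def using polygon_curve_rect[OF assms] rect_interior_props[OF assms]
    by (intro conjI allI exI[of _ "rect_interior b"]) auto
qed

lemma convex_polygon_tri: "convex_polygon tri"
proof -
  have "\<not> collinear {vert tri i, vert tri (Suc i), vert tri (Suc (Suc i))}" for i
  proof -
    have "i mod 3 < 3" by simp
    then consider "i mod 3 = 0" | "i mod 3 = 1" | "i mod 3 = 2" by linarith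
    then show ?thesis
      by cases (auto simp: vert_def tri_def mod_Suc intro!: not_collinear_pt)
  qed
  moreover have "distinct tri" "length tri \<ge> 3" by (auto simp: tri_def)
  ultimately show ?thesis
    unfolding convex_polygon_def using polygon_curve_tri tri_interior_props
    by (intro conjI allI exI[of _ tri_interior]) auto
qed

section \<open>Chords of open convex regions and the billiard map\<close>

lemma inside_frontier_open_convex:
  fixes C :: "'a::euclidean_space set"
  assumes "open C" "convex C" "bounded C"
  shows "inside (frontier C) = C"
  using assms inside_frontier_eq_interior[of C] interior_open by auto

text \<open>The midpoint cuts the segment into two halves, each joining a point of the open convex
  set to a point of its closure. Whether a chord runs inside the polygon thus becomes a test at a
  single point.\<close>

lemma open_segment_subset_of_midpoint:
  fixes C :: "'a::euclidean_space set"
  assumes "open C" "convex C" "x \<in> closure C" "z \<in> closure C" "midpoint x z \<in> C"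
  shows "open_segment x z \<subseteq> C"
proof -
  let ?m = "midpoint x z"
  have "open_segment ?m x \<subseteq> C" "open_segment ?m z \<subseteq> C"
    using assms in_interior_closure_convex_segment[of C ?m] by (simp_all add: interior_open)
  moreover have "open_segment x z \<subseteq> insert ?m (open_segment ?m x \<union> open_segment ?m z)"
  proof (cases "x = z")
    case False
    then have "open_segment x ?m \<union> {?m} \<union> open_segment ?m z = open_segment x z"
      by (intro Un_open_segment) simp
    then show ?thesis by (auto simp: open_segment_commute[of ?m x])
  qed simp
  ultimately show ?thesis using assms by blast
qed


text \<open>This is the uniqueness in condition A. With \<open>z' - x = r *\<^sub>R (z - x)\<close>,
  a negative \<open>r\<close> puts \<open>x\<close> between two points of \<open>C\<close>, and a
  positive \<open>r\<close> other than 1 puts one of \<open>z\<close>, \<open>z'\<close> on the open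
  chord ending at the other.\<close>

lemma chord_end_unique:
  fixes C :: "'a::euclidean_space set"
  assumes C: "open C" "convex C" and x: "x \<notin> C" "x \<noteq> z" "x \<noteq> z'"
    and z: "z \<notin> C" "z' \<notin> C" and v: "z - x \<in> span {v}" "z' - x \<in> span {v}"
    and seg: "open_segment x z \<subseteq> C" "open_segment x z' \<subseteq> C"
  shows "z = z'"
proof -
  obtain k k' where k: "z - x = k *\<^sub>R v" "z' - x = k' *\<^sub>R v"
    using v by (auto simp: span_singleton)
  then have "k \<noteq> 0" "k' \<noteq> 0" using x by auto
  define r where "r = k' / k"
  have "r \<noteq> 0" and "z' - x = r *\<^sub>R (z - x)"
    using \<open>k \<noteq> 0\<close> \<open>k' \<noteq> 0\<close> k by (auto simp: r_def)
  then have z': "z' = x + r *\<^sub>R (z - x)" by (simp add: algebra_simps)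
  consider "r < 0" | "0 < r" "r < 1" | "r = 1" | "1 < r" using \<open>r \<noteq> 0\<close> by linarith
  then show ?thesis
  proof cases
    case 1
    have "midpoint x z \<in> C" "midpoint x z' \<in> C" using seg x by auto
    \<comment> \<open>The midpoints are \<open>x + (1/2) *\<^sub>R d\<close> and
      \<open>x + (r/2) *\<^sub>R d\<close> with \<open>d = z - x\<close>; the weight
      \<open>1 / (1 - r)\<close> is the one that cancels \<open>d\<close>, and it lies in the unit
      interval because \<open>r < 0\<close>.\<close>
    moreover have "x = (1 - 1 / (1 - r)) *\<^sub>R midpoint x z + (1 / (1 - r)) *\<^sub>R midpoint x z'"
    proof -
      define d u where "d = z - x" and "u = 1 / (1 - r)"
      have "midpoint x (x + w) = x + (1 / 2) *\<^sub>R w" for w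
        by (rule euclidean_eqI) (simp add: midpoint_def inner_simps field_simps)
      from this[of d] this[of "r *\<^sub>R d"]
      have mid: "midpoint x z = x + (1 / 2) *\<^sub>R d" "midpoint x z' = x + (r / 2) *\<^sub>R d"
        by (simp_all add: z' d_def)
      have "(1 - u) *\<^sub>R midpoint x z + u *\<^sub>R midpoint x z' = x + ((1 - u * (1 - r)) / 2) *\<^sub>R d"
        unfolding mid by (simp add: algebra_simps diff_divide_distrib add_divide_distrib)
      also have "1 - u * (1 - r) = 0" using 1 by (simp add: u_def)
      finally show ?thesis by (simp add: u_def)
    qed
    ultimately have "x \<in> C"
      using convexD_alt[OF C(2), of "midpoint x z" "midpoint x z'" "1 / (1 - r)"] 1 by simp
    then show ?thesis using x by simp
  next
    case 2
    then have "z' \<in> open_segment x z"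
      using x unfolding in_segment z' by (auto intro!: exI[of _ r] simp: algebra_simps)
    then show ?thesis using seg z by blast
  next
    case 3
    then show ?thesis using z' by simp
  next
    case 4
    have "z = (1 - 1 / r) *\<^sub>R x + (1 / r) *\<^sub>R z'"
      using 4 by (simp add: z' algebra_simps)
    then have "z \<in> open_segment x z'"
      using x 4 unfolding in_segment by (auto intro!: exI[of _ "1 / r"])
    then show ?thesis using seg z by blast
  qed
qed

text \<open>Every explicit move rests on this rule: one candidate \<open>z\<close> in the right
  direction with an interior midpoint settles existence, and convexity settles uniqueness.\<close>

lemma P_max_billiard_mapI:
  assumes curve: "polygon_curve (Q s) = frontier C" and C: "open C" "convex C" "bounded C"
    and T: "tangent_line (Q (opp s)) y = span {v}"
    and x: "x \<in> polygon_curve (Q s)"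
    and y: "y \<in> polygon_curve (Q (opp s))" "y \<notin> set (Q (opp s))"
    and z: "z \<in> polygon_curve (Q s)" "z - x \<in> span {v}" "midpoint x z \<in> C"
  shows "(s, x, y) \<in> P_max Q" and "billiard_map Q (s, x, y) = (opp s, y, z)"
proof -
  have disj: "w \<notin> C" if "w \<in> polygon_curve (Q s)" for w
    using that C(1) by (simp add: curve frontier_def interior_open)
  have inside: "inside (polygon_curve (Q s)) = C"
    unfolding curve by (rule inside_frontier_open_convex[OF C])
  \<comment> \<open>If \<open>x = z\<close>, the midpoint would be the boundary point
    \<open>x\<close>, which is not in the open set \<open>C\<close>.\<close>
  have "x \<noteq> z" using disj[OF x] z(3) by auto
  have shift: "(\<exists>t. w = x + t \<and> t \<in> span {v} \<and> t \<noteq> 0) \<longleftrightarrow> w - x \<in> span {v} \<and> x \<noteq> w" for w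
    by (auto intro: exI[of _ "w - x"])
  have succ: "is_successor Q (s, x, y) w \<longleftrightarrow>
      w \<in> polygon_curve (Q s) \<and> w - x \<in> span {v} \<and> x \<noteq> w \<and> open_segment x w \<subseteq> C" for w
    using shift[of w] by (simp add: is_successor_def T inside)
  have "polygon_curve (Q s) \<subseteq> closure C"
    unfolding curve by (simp add: frontier_def)
  then have "open_segment x z \<subseteq> C"
    using open_segment_subset_of_midpoint[OF C(1,2) _ _ z(3)] x z(1) by blast
  then have z_succ: "is_successor Q (s, x, y) z"
    unfolding succ using z(1,2) \<open>x \<noteq> z\<close> by simp
  have uniq: "w = z" if "is_successor Q (s, x, y) w" for w
    using chord_end_unique[OF C(1,2), of x w z v] that z_succ disj[OF x] disj[of w] disj[OF z(1)]
    unfolding succ by blast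
  have "\<exists>!w. is_successor Q (s, x, y) w"
    using z_succ uniq by blast
  then show "(s, x, y) \<in> P_max Q"
    using x y by (simp add: P_max_def states_def condition_A_def)
  show "billiard_map Q (s, x, y) = (opp s, y, z)"
    using the_equality[of "is_successor Q (s, x, y)", OF z_succ uniq] by (simp add: billiard_map_def)
qed

section \<open>Directions of the sides\<close>

lemma span_pt:
  "c \<noteq> 0 \<Longrightarrow> span {pt c 0} = {t. t$2 = 0}"
  "c \<noteq> 0 \<Longrightarrow> span {pt 0 c} = {t. t$1 = 0}"
  "c \<noteq> 0 \<Longrightarrow> span {pt (- c) c} = {t. t$1 + t$2 = 0}"
proof -
  have *: "span {v} = {t. \<exists>k. t = k *\<^sub>R v}" for v :: "real^2"
    by (auto simp: span_singleton)
  show "span {pt c 0} = {t. t$2 = 0}" if "c \<noteq> 0"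
    using that unfolding *
    by (auto simp: vec_eq_iff forall_2 intro!: exI[of _ "_ / c"])
  show "span {pt 0 c} = {t. t$1 = 0}" if "c \<noteq> 0"
    using that unfolding *
    by (auto simp: vec_eq_iff forall_2 intro!: exI[of _ "_ / c"])
  show "span {pt (- c) c} = {t. t$1 + t$2 = 0}" if "c \<noteq> 0"
    using that unfolding *
    by (auto simp: vec_eq_iff forall_2 intro!: exI[of _ "_ $ 2 / c"])
qed

lemma open_segment_pt_rev:
  "a < c \<Longrightarrow> pt p q \<in> open_segment (pt c b) (pt a b) \<longleftrightarrow> q = b \<and> a < p \<and> p < c"
  "b < d \<Longrightarrow> pt p q \<in> open_segment (pt a d) (pt a b) \<longleftrightarrow> p = a \<and> b < q \<and> q < d"
  by (auto simp: open_segment_pt open_segment_commute[of "pt c b" "pt a b"]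
      open_segment_commute[of "pt a d" "pt a b"])

lemma Union_edges_rect:
  "(\<Union>i\<in>{i. i < length (rect b) \<and> P i}. f i) =
    (if P 0 then f 0 else {}) \<union> (if P 1 then f 1 else {}) \<union>
    (if P 2 then f 2 else {}) \<union> (if P 3 then f 3 else {})"
proof -
  have "{i. i < length (rect b) \<and> P i} = {i \<in> {0, 1, 2, 3}. P i}"
    by (auto simp: rect_def tri_def)
  then show ?thesis by auto
qed

lemma Union_edges_tri:
  "(\<Union>i\<in>{i. i < length tri \<and> P i}. f i) =
    (if P 0 then f 0 else {}) \<union> (if P 1 then f 1 else {}) \<union> (if P 2 then f 2 else {})"
proof -
  have "{i. i < length tri \<and> P i} = {i \<in> {0, 1, 2}. P i}"
    by (auto simp: rect_def tri_def)
  then show ?thesis by auto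
qed

lemma tangent_line_rect:
  assumes "b > 0"
  shows "0 < p \<Longrightarrow> p < 1 \<Longrightarrow> q = 0 \<or> q = b \<Longrightarrow> tangent_line (rect b) (pt p q) = span {pt 1 0}"
    and "p = 0 \<or> p = 1 \<Longrightarrow> 0 < q \<Longrightarrow> q < b \<Longrightarrow> tangent_line (rect b) (pt p q) = span {pt 0 1}"
  using assms unfolding tangent_line_def Union_edges_rect
  by (auto simp: vert_simps open_segment_pt open_segment_pt_rev span_pt)

text \<open>All three sides share the parameter of the hypotenuse: \<open>pt t 0\<close> and
  \<open>pt 0 (1 - t)\<close> are the vertical and horizontal projections of
  \<open>pt t (1 - t)\<close> to the legs.\<close>

lemma tangent_line_tri:
  shows "0 < t \<Longrightarrow> t < 1 \<Longrightarrow> tangent_line tri (pt t 0) = span {pt 1 0}"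
    and "0 < t \<Longrightarrow> t < 1 \<Longrightarrow> tangent_line tri (pt 0 (1 - t)) = span {pt 0 1}"
    and "0 < t \<Longrightarrow> t < 1 \<Longrightarrow> tangent_line tri (pt t (1 - t)) = span {pt (-1) 1}"
  unfolding tangent_line_def Union_edges_tri
  by (auto simp: vert_simps open_segment_pt open_segment_pt_rev span_pt)


section \<open>The explicit moves of the pair\<close>

definition rect_tri :: "real \<Rightarrow> polygon_pair" where
  "rect_tri b = (\<lambda>s. case s of Minus \<Rightarrow> rect b | Plus \<Rightarrow> tri)"

lemma rect_tri_simps [simp]: "rect_tri b Minus = rect b" "rect_tri b Plus = tri"
  by (simp_all add: rect_tri_def)

lemma pt_in_set_iff:
  "pt p q \<in> set (rect b) \<longleftrightarrow> (p = 0 \<or> p = 1) \<and> (q = 0 \<or> q = b)"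
  "pt p q \<in> set tri \<longleftrightarrow> p = 0 \<and> q = 0 \<or> p = 1 \<and> q = 0 \<or> p = 0 \<and> q = 1"
  by (auto simp: rect_def tri_def)

text \<open>Membership in the domain is recorded together with the value, since the singular sets
  are preimages under the map restricted to \<open>P_max\<close>.\<close>

definition moves_to :: "polygon_pair \<Rightarrow> state \<Rightarrow> state \<Rightarrow> bool" where
  "moves_to Q p p' \<longleftrightarrow> p \<in> P_max Q \<and> billiard_map Q p = p'"

lemma moves_to_rect:
  assumes b: "b > 0" and "tangent_line tri y = span {v}"
    "y \<in> polygon_curve tri" "y \<notin> set tri"
    "x \<in> polygon_curve (rect b)" "z \<in> polygon_curve (rect b)"
    "z - x \<in> span {v}" "midpoint x z \<in> rect_interior b"
  shows "moves_to (rect_tri b) (Minus, x, y) (Plus, y, z)"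
  using P_max_billiard_mapI[of "rect_tri b" Minus "rect_interior b" y v x z] assms
    polygon_curve_rect[OF b] rect_interior_props[OF b] by (simp add: moves_to_def)

lemma moves_to_tri:
  assumes "tangent_line (rect b) x = span {v}"
    "x \<in> polygon_curve (rect b)" "x \<notin> set (rect b)"
    "y \<in> polygon_curve tri" "z \<in> polygon_curve tri"
    "z - y \<in> span {v}" "midpoint y z \<in> tri_interior"
  shows "moves_to (rect_tri b) (Plus, y, x) (Minus, x, z)"
  using P_max_billiard_mapI[of "rect_tri b" Plus tri_interior x v y z] assms
    polygon_curve_tri tri_interior_props by (simp add: moves_to_def)

text \<open>The chord of slope \<open>-1\<close> of the rectangle on which the coordinates sum to \<open>s\<close> joins
  \<open>upper b s\<close>, on the left or top side, to \<open>lower s\<close>, on the bottom or right side.\<close>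

definition upper :: "real \<Rightarrow> real \<Rightarrow> real^2" where
  "upper b s = (if s \<le> b then pt 0 s else pt (s - b) b)"

definition lower :: "real \<Rightarrow> real^2" where
  "lower s = (if s \<le> 1 then pt s 0 else pt 1 (s - 1))"

lemma midpoint_pt: "midpoint (pt p q) (pt r s) = pt ((p + r) / 2) ((q + s) / 2)"
  by (simp add: midpoint_def vec_eq_iff forall_2)

text \<open>Both ends have coordinate sum \<open>s\<close>, and \<open>0 < s < 1 + b\<close> puts
  their midpoint in the interior. Only the point giving the direction must avoid the vertices, so an
  end at a corner (\<open>s = b\<close> or \<open>s = 1\<close>) is allowed.\<close>

lemma moves_to_antidiagonal:
  assumes "b > 0" "0 < s" "s < 1 + b" "0 < t" "t < 1"
  shows "moves_to (rect_tri b) (Minus, lower s, pt t (1 - t)) (Plus, pt t (1 - t), upper b s)"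
    and "moves_to (rect_tri b) (Minus, upper b s, pt t (1 - t)) (Plus, pt t (1 - t), lower s)"
  using assms
  by (auto intro!: moves_to_rect[where v = "pt (-1) 1"] simp: tangent_line_tri polygon_curve_tri_iff
      pt_in_set_iff polygon_curve_rect_iff span_pt upper_def lower_def midpoint_pt rect_interior_def)

text \<open>The three moves of one excursion: the triangle point drops to the bottom leg, the
  rectangle point crosses horizontally, and the triangle point returns to the same place on the
  hypotenuse.\<close>

lemma moves_to_vertical_side:
  assumes "b > 0" "p = 0 \<or> p = 1" "0 < q" "q < b" "0 < t" "t < 1"
  shows "moves_to (rect_tri b) (Plus, pt t (1 - t), pt p q) (Minus, pt p q, pt t 0)"
    and "moves_to (rect_tri b) (Minus, pt p q, pt t 0) (Plus, pt t 0, pt (1 - p) q)"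
    and "moves_to (rect_tri b) (Plus, pt t 0, pt p q) (Minus, pt p q, pt t (1 - t))"
  using assms
  by (auto intro!: moves_to_rect[where v = "pt 1 0"] moves_to_tri[where v = "pt 0 1"]
      simp: tangent_line_tri tangent_line_rect polygon_curve_tri_iff
      pt_in_set_iff polygon_curve_rect_iff span_pt midpoint_pt rect_interior_def tri_interior_def) (simp_all add: field_simps)

text \<open>The same excursion with the coordinates exchanged, through the left leg and with a
  vertical crossing.\<close>

lemma moves_to_horizontal_side:
  assumes "b > 0" "0 < p" "p < 1" "q = 0 \<or> q = b" "0 < t" "t < 1"
  shows "moves_to (rect_tri b) (Plus, pt t (1 - t), pt p q) (Minus, pt p q, pt 0 (1 - t))"
    and "moves_to (rect_tri b) (Minus, pt p q, pt 0 (1 - t)) (Plus, pt 0 (1 - t), pt p (b - q))"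
    and "moves_to (rect_tri b) (Plus, pt 0 (1 - t), pt p q) (Minus, pt p q, pt t (1 - t))"
  using assms
  by (auto intro!: moves_to_rect[where v = "pt 0 1"] moves_to_tri[where v = "pt 1 0"]
      simp: tangent_line_tri tangent_line_rect polygon_curve_tri_iff
      pt_in_set_iff polygon_curve_rect_iff span_pt midpoint_pt rect_interior_def tri_interior_def) (simp_all add: field_simps)

section \<open>Regular states, the return after four moves, and irrational rotation\<close>

definition regular :: "polygon_pair \<Rightarrow> state \<Rightarrow> bool" where
  "regular Q p \<longleftrightarrow> p \<notin> (\<Union>i. singular Q i)"

text \<open>If the image lay in \<open>singular Q i\<close>, the state itself would lie in
  \<open>singular Q (Suc i)\<close>. The argument concerns preimages, so \<open>regular\<close>
  refers to the unswapped part of the singular set.\<close>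

lemma regular_moves_to:
  assumes "regular Q p" "moves_to Q p p'"
  shows "regular Q p'"
proof -
  have "p' \<notin> singular Q i" for i
    using assms by (auto simp: regular_def moves_to_def dest: spec[of _ "Suc i"])
  then show ?thesis by (simp add: regular_def)
qed

lemma regular_not_vertex:
  "regular Q (s, x, y) \<Longrightarrow> x \<in> polygon_curve (Q s) \<Longrightarrow> y \<notin> set (Q (opp s))"
  by (auto simp: regular_def dest: spec[of _ 0])

lemma four_moves:
  assumes "moves_to Q p0 p1" "moves_to Q p1 p2" "moves_to Q p2 p3" "moves_to Q p3 p4" "regular Q p0"
  shows "(billiard_map Q ^^ 4) p0 = p4 \<and> regular Q p4"
proof
  show "(billiard_map Q ^^ 4) p0 = p4"
    using assms by (auto simp: moves_to_def numeral_eq_Suc)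
  show "regular Q p4"
    by (intro regular_moves_to[OF _ assms(4)] regular_moves_to[OF _ assms(3)]
        regular_moves_to[OF _ assms(2)] regular_moves_to[OF _ assms(1)] assms(5))
qed

text \<open>The antidiagonal chord ends on the left side if \<open>s < b\<close> and on the top side
  if \<open>s > b\<close>. The crossing then leads to the right side at the same height, adding 1 to
  the sum, or straight down to the bottom side, subtracting \<open>b\<close>.\<close>

lemma return_lower:
  assumes b: "b > 0" and s: "0 < s" "s < 1 + b" and t: "0 < t" "t < 1"
    and reg: "regular (rect_tri b) (Minus, lower s, pt t (1 - t))"
  shows "\<exists>s'. (0 < s' \<and> s' < 1 + b \<and> regular (rect_tri b) (Minus, lower s', pt t (1 - t))) \<and>
    (s' = s + 1 \<or> s' = s - b) \<and>
    (billiard_map (rect_tri b) ^^ 4) (Minus, lower s, pt t (1 - t)) = (Minus, lower s', pt t (1 - t))"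
proof -
  note step = moves_to_antidiagonal(1)[OF b s t]
  \<comment> \<open>After the first move \<open>upper b s\<close> is the direction point, so
    regularity keeps it off the corners; this excludes \<open>s = b\<close>, where no excursion is
    possible.\<close>
  have "upper b s \<notin> set (rect b)"
    using regular_not_vertex[OF regular_moves_to[OF reg step]] t by (simp add: polygon_curve_tri_iff)
  then have "s \<noteq> b" using s by (auto simp: upper_def pt_in_set_iff)
  then consider "s < b" | "b < s" by linarith
  then show ?thesis
  proof cases
    case 1
    then have eq: "upper b s = pt 0 s" "lower (s + 1) = pt 1 s"
      using s by (auto simp: upper_def lower_def)
    note vert = moves_to_vertical_side[OF b _ s(1) 1 t]
    show ?thesis
      using four_moves[OF step[unfolded eq] vert(1,2,3) reg] 1 s
      by (intro exI[of _ "s + 1"]) (simp add: eq)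
  next
    case 2
    then have eq: "upper b s = pt (s - b) b" "lower (s - b) = pt (s - b) 0" and p: "0 < s - b" "s - b < 1"
      using s by (auto simp: upper_def lower_def)
    note hor = moves_to_horizontal_side[OF b p _ t]
    show ?thesis
      using four_moves[OF step[unfolded eq] hor(1,2,3) reg] 2 s b
      by (intro exI[of _ "s - b"]) (simp add: eq)
  qed
qed

text \<open>The counterpart for the other two sides: here the chord ends on the bottom or right
  side, and the critical value is \<open>s = 1\<close>.\<close>

lemma return_upper:
  assumes b: "b > 0" and s: "0 < s" "s < 1 + b" and t: "0 < t" "t < 1"
    and reg: "regular (rect_tri b) (Minus, upper b s, pt t (1 - t))"
  shows "\<exists>s'. (0 < s' \<and> s' < 1 + b \<and> regular (rect_tri b) (Minus, upper b s', pt t (1 - t))) \<and>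
    (s' = s + b \<or> s' = s - 1) \<and>
    (billiard_map (rect_tri b) ^^ 4) (Minus, upper b s, pt t (1 - t)) = (Minus, upper b s', pt t (1 - t))"
proof -
  note step = moves_to_antidiagonal(2)[OF b s t]
  have "lower s \<notin> set (rect b)"
    using regular_not_vertex[OF regular_moves_to[OF reg step]] t by (simp add: polygon_curve_tri_iff)
  then have "s \<noteq> 1" using s by (auto simp: lower_def pt_in_set_iff)
  then consider "s < 1" | "1 < s" by linarith
  then show ?thesis
  proof cases
    case 1
    then have eq: "lower s = pt s 0" "upper b (s + b) = pt s b"
      using s by (auto simp: upper_def lower_def)
    note hor = moves_to_horizontal_side[OF b s(1) 1 _ t]
    show ?thesis
      using four_moves[OF step[unfolded eq] hor(1,2,3) reg] 1 s b
      by (intro exI[of _ "s + b"]) (simp add: eq)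
  next
    case 2
    then have eq: "lower s = pt 1 (s - 1)" "upper b (s - 1) = pt 0 (s - 1)" and q: "0 < s - 1" "s - 1 < b"
      using s by (auto simp: upper_def lower_def)
    note vert = moves_to_vertical_side[OF b _ q t]
    show ?thesis
      using four_moves[OF step[unfolded eq] vert(1,2,3) reg] 2 s b
      by (intro exI[of _ "s - 1"]) (simp add: eq)
  qed
qed

text \<open>After \<open>k\<close> returns the parameter has moved by
  \<open>i * \<alpha> - j * \<beta>\<close> with \<open>i + j = k\<close>. Coming back would make
  this zero, against the irrationality of the ratio. \<open>P\<close> carries the range of the
  parameter and the regularity that the next return requires.\<close>

lemma rotation_no_return:
  fixes \<phi> :: "'a \<Rightarrow> 'a" and g :: "real \<Rightarrow> 'a"
  assumes ret: "\<And>s. P s \<Longrightarrow> \<exists>s'. P s' \<and> (s' = s + \<alpha> \<or> s' = s - \<beta>) \<and> (\<phi> ^^ 4) (g s) = g s'"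
    and inj: "inj_on g {s. P s}" and ab: "\<alpha> > 0" "\<beta> > 0" "\<alpha> / \<beta> \<notin> \<rat>"
    and s: "P s" and n: "n \<ge> 1"
  shows "(\<phi> ^^ n) (g s) \<noteq> g s"
proof
  assume per: "(\<phi> ^^ n) (g s) = g s"
  have iter: "\<exists>i j. i + j = k \<and> P (s + real i * \<alpha> - real j * \<beta>) \<and>
      ((\<phi> ^^ 4) ^^ k) (g s) = g (s + real i * \<alpha> - real j * \<beta>)" for k
  proof (induction k)
    case (Suc k)
    then obtain i j where ij: "i + j = k" "P (s + real i * \<alpha> - real j * \<beta>)"
      "((\<phi> ^^ 4) ^^ k) (g s) = g (s + real i * \<alpha> - real j * \<beta>)" by blast
    from ret[OF ij(2)] obtain s' where s': "P s'"
      "s' = s + real i * \<alpha> - real j * \<beta> + \<alpha> \<or> s' = s + real i * \<alpha> - real j * \<beta> - \<beta>"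
      "((\<phi> ^^ 4) ^^ Suc k) (g s) = g s'"
      using ij(3) by auto
    from s'(2) consider "s' = s + real (Suc i) * \<alpha> - real j * \<beta>" | "s' = s + real i * \<alpha> - real (Suc j) * \<beta>"
      by (auto simp: algebra_simps)
    then show ?case
    proof cases
      case 1
      then show ?thesis using s'(1,3) ij(1) by (intro exI[of _ "Suc i"] exI[of _ j]) simp
    next
      case 2
      then show ?thesis using s'(1,3) ij(1) by (intro exI[of _ i] exI[of _ "Suc j"]) simp
    qed
  qed (use s in simp)
  \<comment> \<open>The period need not be a multiple of 4, so four full periods are compared with
    \<open>n\<close> returns.\<close>
  have "((\<phi> ^^ n) ^^ k) (g s) = g s" for k
    by (induction k) (simp_all add: per)
  from this[of 4] have "((\<phi> ^^ 4) ^^ n) (g s) = g s"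
    unfolding funpow_mult by (simp add: mult.commute)
  with iter[of n] obtain i j where ij: "i + j = n" "P (s + real i * \<alpha> - real j * \<beta>)"
    "g (s + real i * \<alpha> - real j * \<beta>) = g s" by auto
  then have eq: "real i * \<alpha> = real j * \<beta>"
    using inj_onD[OF inj ij(3)] s by simp
  show False
  \<comment> \<open>For \<open>i = 0\<close> the other count is \<open>j = n\<close>, which is
    positive, so the displacement is nonzero; otherwise division by \<open>i\<close> is
    legitimate.\<close>
  proof (cases "i = 0")
    case True
    then show False using eq ab ij(1) n by simp
  next
    case False
    then have "\<alpha> / \<beta> = real j / real i" using eq ab by (simp add: field_simps)
    then show False using ab(3) by simp
  qed
qed

section \<open>Every orbit of the phase space reaches the hypotenuse\<close>

lemma P_max_chord:
  assumes "(s, x, y) \<in> P_max Q" "inside (polygon_curve (Q s)) = C"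
    "tangent_line (Q (opp s)) y = span {v}"
  obtains z where "z - x \<in> span {v}" "midpoint x z \<in> C"
proof -
  from assms(1) obtain z where "is_successor Q (s, x, y) z"
    by (auto simp: P_max_def condition_A_def)
  then obtain t where z: "z = x + t" "t \<in> span {v}" "t \<noteq> 0" "open_segment x z \<subseteq> C"
    using assms(2,3) by (auto simp: is_successor_def)
  moreover from this have "midpoint x z \<in> C" by auto
  ultimately show thesis using that[of z] by simp
qed

text \<open>A chord starting on a side parallel to its direction stays on the line of that side, so
  its midpoint cannot be interior.\<close>

lemma P_max_rect_sides:
  assumes b: "b > 0" and p: "(Minus, pt p q, y) \<in> P_max (rect_tri b)"
  shows "tangent_line tri y = span {pt 1 0} \<Longrightarrow> q \<noteq> 0 \<and> q \<noteq> b"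
    and "tangent_line tri y = span {pt 0 1} \<Longrightarrow> p \<noteq> 0 \<and> p \<noteq> 1"
proof -
  have ins: "inside (polygon_curve (rect_tri b Minus)) = rect_interior b"
    using inside_frontier_open_convex[of "rect_interior b"] rect_interior_props(1,3,4)[OF b]
      polygon_curve_rect[OF b] by simp
  show "q \<noteq> 0 \<and> q \<noteq> b" if "tangent_line tri y = span {pt 1 0}"
  proof (rule P_max_chord[OF p ins])
    show "tangent_line (rect_tri b (opp Minus)) y = span {pt 1 0}" using that by simp
    fix z assume "z - pt p q \<in> span {pt 1 0}" "midpoint (pt p q) z \<in> rect_interior b"
    then show ?thesis
      by (cases z rule: pt_exhaust) (auto simp: span_pt rect_interior_def midpoint_pt)
  qed
  show "p \<noteq> 0 \<and> p \<noteq> 1" if "tangent_line tri y = span {pt 0 1}"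
  proof (rule P_max_chord[OF p ins])
    show "tangent_line (rect_tri b (opp Minus)) y = span {pt 0 1}" using that by simp
    fix z assume "z - pt p q \<in> span {pt 0 1}" "midpoint (pt p q) z \<in> rect_interior b"
    then show ?thesis
      by (cases z rule: pt_exhaust) (auto simp: span_pt rect_interior_def midpoint_pt)
  qed
qed

lemma P_max_tri_sides:
  assumes p: "(Plus, pt p q, x) \<in> P_max (rect_tri b)"
  shows "tangent_line (rect b) x = span {pt 1 0} \<Longrightarrow> q \<noteq> 0"
    and "tangent_line (rect b) x = span {pt 0 1} \<Longrightarrow> p \<noteq> 0"
proof -
  have ins: "inside (polygon_curve (rect_tri b Plus)) = tri_interior"
    using inside_frontier_open_convex[of tri_interior] tri_interior_props(1,3,4) polygon_curve_tri
    by simp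
  show "q \<noteq> 0" if "tangent_line (rect b) x = span {pt 1 0}"
  proof (rule P_max_chord[OF p ins])
    show "tangent_line (rect_tri b (opp Plus)) x = span {pt 1 0}" using that by simp
    fix z assume "z - pt p q \<in> span {pt 1 0}" "midpoint (pt p q) z \<in> tri_interior"
    then show ?thesis
      by (cases z rule: pt_exhaust) (auto simp: span_pt tri_interior_def midpoint_pt)
  qed
  show "p \<noteq> 0" if "tangent_line (rect b) x = span {pt 0 1}"
  proof (rule P_max_chord[OF p ins])
    show "tangent_line (rect_tri b (opp Plus)) x = span {pt 0 1}" using that by simp
    fix z assume "z - pt p q \<in> span {pt 0 1}" "midpoint (pt p q) z \<in> tri_interior"
    then show ?thesis
      by (cases z rule: pt_exhaust) (auto simp: span_pt tri_interior_def midpoint_pt)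
  qed
qed

text \<open>The two alternatives cover the whole rectangle boundary except the corners
  \<open>pt 0 0\<close> and \<open>pt 1 b\<close>, where the antidiagonal chord degenerates.\<close>

definition in_section :: "real \<Rightarrow> state \<Rightarrow> bool" where
  "in_section b p \<longleftrightarrow> (\<exists>s t. 0 < s \<and> s < 1 + b \<and> 0 < t \<and> t < 1 \<and>
     (p = (Minus, lower s, pt t (1 - t)) \<or> p = (Minus, upper b s, pt t (1 - t))))"

lemma in_sectionI:
  assumes b: "b > 0" and x: "x \<in> polygon_curve (rect b)" "x \<notin> set (rect b)" and t: "0 < t" "t < 1"
  shows "in_section b (Minus, x, pt t (1 - t))"
proof -
  obtain p q where x_eq: "x = pt p q" by (rule pt_exhaust)
  have "x = lower (p + q) \<or> x = upper b (p + q)" "0 < p + q" "p + q < 1 + b"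
    using x b unfolding x_eq by (auto simp: polygon_curve_rect_iff pt_in_set_iff lower_def upper_def)
  then show ?thesis unfolding in_section_def using t by blast
qed

lemma rect_side_cases:
  assumes "b > 0" "x \<in> polygon_curve (rect b)" "x \<notin> set (rect b)"
  obtains p q where "x = pt p q" "0 < p" "p < 1" "q = 0 \<or> q = b"
  | p q where "x = pt p q" "p = 0 \<or> p = 1" "0 < q" "q < b"
proof -
  obtain p q where x: "x = pt p q" by (rule pt_exhaust)
  then have "0 < p \<and> p < 1 \<and> (q = 0 \<or> q = b) \<or> (p = 0 \<or> p = 1) \<and> 0 < q \<and> q < b"
    using assms by (auto simp: polygon_curve_rect_iff pt_in_set_iff)
  then show thesis using that x by blast
qed

lemma tri_side_cases:
  assumes "y \<in> polygon_curve tri" "y \<notin> set tri"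
  obtains t where "0 < t" "t < 1" "y = pt t (1 - t)"
  | t where "0 < t" "t < 1" "y = pt t 0"
  | t where "0 < t" "t < 1" "y = pt 0 (1 - t)"
proof -
  obtain p q where y: "y = pt p q" by (rule pt_exhaust)
  then consider "0 < p" "p < 1" "q = 1 - p" | "0 < p" "p < 1" "q = 0" | "p = 0" "0 < q" "q < 1"
    using assms by (auto simp: polygon_curve_tri_iff pt_in_set_iff)
  then show thesis
  proof cases
    case 3
    then show thesis using that(3)[of "1 - q"] y by simp
  qed (use that y in auto)
qed

text \<open>Regularity is both assumed and concluded, so that the property can be pulled back along
  a move and the returns can start from the state reached.\<close>

definition reaches_section :: "real \<Rightarrow> state \<Rightarrow> bool" where
  "reaches_section b p \<longleftrightarrow> (regular (rect_tri b) p \<longrightarrow>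
     (\<exists>k. in_section b ((billiard_map (rect_tri b) ^^ k) p) \<and>
       regular (rect_tri b) ((billiard_map (rect_tri b) ^^ k) p)))"

lemma moves_to_reaches_section:
  assumes "moves_to (rect_tri b) p p'" "reaches_section b p'"
  shows "reaches_section b p"
  unfolding reaches_section_def
proof
  assume "regular (rect_tri b) p"
  then have "regular (rect_tri b) p'" using regular_moves_to assms(1) by blast
  then obtain k where "in_section b ((billiard_map (rect_tri b) ^^ k) p')"
    "regular (rect_tri b) ((billiard_map (rect_tri b) ^^ k) p')"
    using assms(2) unfolding reaches_section_def by blast
  moreover have "(billiard_map (rect_tri b) ^^ k) p' = (billiard_map (rect_tri b) ^^ Suc k) p"
    using assms(1) by (simp add: moves_to_def funpow_swap1)
  ultimately show "\<exists>k. in_section b ((billiard_map (rect_tri b) ^^ k) p) \<and>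
      regular (rect_tri b) ((billiard_map (rect_tri b) ^^ k) p)"
    by metis
qed

text \<open>A leg parallel to the rectangle side in question is excluded by membership in
  \<open>P_max\<close>. In every other combination of sides the state is at some point of an
  excursion, or at its start, and at most three moves lead to the hypotenuse.\<close>

lemma P_max_reaches_section:
  assumes b: "b > 0" and p: "(sg, x, y) \<in> P_max (rect_tri b)" and x: "x \<notin> set (rect_tri b sg)"
  shows "reaches_section b (sg, x, y)"
proof -
  have curve: "x \<in> polygon_curve (rect_tri b sg)" "y \<in> polygon_curve (rect_tri b (opp sg))"
    and y: "y \<notin> set (rect_tri b (opp sg))"
    using p by (auto simp: P_max_def states_def condition_A_def)
  have hyp: "reaches_section b (Minus, w, pt t (1 - t))"
    if "w \<in> polygon_curve (rect b)" "w \<notin> set (rect b)" "0 < t" "t < 1" for w t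
    unfolding reaches_section_def using in_sectionI[OF b that] by (metis funpow_0)
  show ?thesis
  proof (cases sg)
    case Minus
    with curve x y have xr: "x \<in> polygon_curve (rect b)" "x \<notin> set (rect b)"
      and yt: "y \<in> polygon_curve tri" "y \<notin> set tri" by auto
    note p = p[unfolded Minus]
    from yt show ?thesis unfolding Minus
    proof (cases rule: tri_side_cases)
      case (1 t)
      then show "reaches_section b (Minus, x, y)" using hyp xr by simp
    next
      case (2 t)
      from b xr show "reaches_section b (Minus, x, y)"
      proof (cases rule: rect_side_cases)
        case (1 p q)
        \<comment> \<open>Here side and leg are both horizontal, so there is no chord.\<close>
        then show ?thesis using P_max_rect_sides(1)[OF b] p tangent_line_tri(1) 2 by blast
      next
        case x: (2 p q)
        then have x': "1 - p = 0 \<or> 1 - p = 1" by auto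
        note side = moves_to_vertical_side[OF b _ x(3,4) 2(1,2)]
        show ?thesis unfolding x(1) 2(3)
          by (rule moves_to_reaches_section[OF side(2)[OF x(2)]], rule moves_to_reaches_section[OF side(3)[OF x']],
              rule hyp) (use x b 2 in \<open>auto simp: polygon_curve_rect_iff pt_in_set_iff\<close>)
      qed
    next
      case (3 t)
      from b xr show "reaches_section b (Minus, x, y)"
      proof (cases rule: rect_side_cases)
        case (2 p q)
        then show ?thesis using P_max_rect_sides(2)[OF b] p tangent_line_tri(2) 3 by blast
      next
        case x: (1 p q)
        then have x': "b - q = 0 \<or> b - q = b" by auto
        note side = moves_to_horizontal_side[OF b x(2,3) _ 3(1,2)]
        show ?thesis unfolding x(1) 3(3)
          by (rule moves_to_reaches_section[OF side(2)[OF x(4)]], rule moves_to_reaches_section[OF side(3)[OF x']],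
              rule hyp) (use x b 3 in \<open>auto simp: polygon_curve_rect_iff pt_in_set_iff\<close>)
      qed
    qed
  next
    case Plus
    with curve x y have yr: "y \<in> polygon_curve (rect b)" "y \<notin> set (rect b)"
      and xt: "x \<in> polygon_curve tri" "x \<notin> set tri" by auto
    note p = p[unfolded Plus]
    from b yr show ?thesis unfolding Plus
    proof (cases rule: rect_side_cases)
      case y: (1 p q)
      then have y': "b - q = 0 \<or> b - q = b" by auto
      from xt show "reaches_section b (Plus, x, y)"
      proof (cases rule: tri_side_cases)
        case (2 t)
        then show ?thesis using P_max_tri_sides(1) p tangent_line_rect(1)[OF b y(2,3,4)] y(1) by blast
      next
        case (1 t)
        note side = moves_to_horizontal_side[OF b y(2,3) _ 1(1,2)]
        show ?thesis unfolding y(1) 1(3)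
          by (rule moves_to_reaches_section[OF side(1)[OF y(4)]], rule moves_to_reaches_section[OF side(2)[OF y(4)]],
              rule moves_to_reaches_section[OF side(3)[OF y']], rule hyp)
            (use y b 1 in \<open>auto simp: polygon_curve_rect_iff pt_in_set_iff\<close>)
      next
        case (3 t)
        note side = moves_to_horizontal_side[OF b y(2,3) _ 3(1,2)]
        show ?thesis unfolding y(1) 3(3)
          by (rule moves_to_reaches_section[OF side(3)[OF y(4)]], rule hyp)
            (use yr y b 3 in auto)
      qed
    next
      case y: (2 p q)
      then have y': "1 - p = 0 \<or> 1 - p = 1" by auto
      from xt show "reaches_section b (Plus, x, y)"
      proof (cases rule: tri_side_cases)
        case (3 t)
        then show ?thesis using P_max_tri_sides(2) p tangent_line_rect(2)[OF b y(2,3,4)] y(1) by blast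
      next
        case (1 t)
        note side = moves_to_vertical_side[OF b _ y(3,4) 1(1,2)]
        show ?thesis unfolding y(1) 1(3)
          by (rule moves_to_reaches_section[OF side(1)[OF y(2)]], rule moves_to_reaches_section[OF side(2)[OF y(2)]],
              rule moves_to_reaches_section[OF side(3)[OF y']], rule hyp)
            (use y b 1 in \<open>auto simp: polygon_curve_rect_iff pt_in_set_iff\<close>)
      next
        case (2 t)
        note side = moves_to_vertical_side[OF b _ y(3,4) 2(1,2)]
        show ?thesis unfolding y(1) 2(3)
          by (rule moves_to_reaches_section[OF side(3)[OF y(2)]], rule hyp)
            (use yr y b 2 in auto)
      qed
    qed
  qed
qed

section \<open>Aperiodicity on the phase space\<close>

lemma phase_space_regular:
  assumes "(sg, x, y) \<in> phase_space Q"
  shows "(sg, x, y) \<in> P_max Q" "regular Q (sg, x, y)" "x \<notin> set (Q sg)"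
proof -
  show P: "(sg, x, y) \<in> P_max Q" and "regular Q (sg, x, y)"
    using assms by (auto simp: phase_space_def singular_set_def regular_def)
  show "x \<notin> set (Q sg)"
  proof
    have opp: "opp (opp sg) = sg" by (cases sg) auto
    assume "x \<in> set (Q sg)"
    \<comment> \<open>The swapped half of the singular set enters here: it keeps the first component
      of an initial state off the vertices.\<close>
    then have "(opp sg, y, x) \<in> singular Q 0"
      using P by (auto simp: P_max_def states_def opp)
    then have "swap_state (opp sg, y, x) \<in> singular_set Q"
      unfolding singular_set_def by blast
    then show False using assms by (simp add: phase_space_def opp)
  qed
qed

text \<open>Neither return switches between \<open>lower\<close> and \<open>upper\<close>, so each
  branch is a separate rotation: with steps 1 and \<open>b\<close> on the first, \<open>b\<close>
  and 1 on the second.\<close>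

lemma section_no_return:
  assumes b: "b > 0" "b \<notin> \<rat>" and p: "in_section b p" "regular (rect_tri b) p" and n: "n \<ge> 1"
  shows "(billiard_map (rect_tri b) ^^ n) p \<noteq> p"
proof -
  obtain s t where s: "0 < s" "s < 1 + b" and t: "0 < t" "t < 1"
    and p_eq: "p = (Minus, lower s, pt t (1 - t)) \<or> p = (Minus, upper b s, pt t (1 - t))"
    using p(1) unfolding in_section_def by blast
  have irr: "1 / b \<notin> \<rat>" "b / 1 \<notin> \<rat>"
    using b(2) Rats_inverse[of "1 / b"] by (auto simp: field_simps)
  have inj: "inj lower" "inj (upper b)"
    by (auto simp: inj_def lower_def upper_def split: if_splits)
  from p_eq show ?thesis
  proof
    assume p_eq: "p = (Minus, lower s, pt t (1 - t))"
    show ?thesis unfolding p_eq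
    proof (rule rotation_no_return[OF _ _ zero_less_one b(1) irr(1) _ n,
          where P = "\<lambda>s. 0 < s \<and> s < 1 + b \<and> regular (rect_tri b) (Minus, lower s, pt t (1 - t))"
            and g = "\<lambda>s. (Minus, lower s, pt t (1 - t))" and s = s])
      show "inj_on (\<lambda>s. (Minus, lower s, pt t (1 - t)))
        {s. 0 < s \<and> s < 1 + b \<and> regular (rect_tri b) (Minus, lower s, pt t (1 - t))}"
        using inj(1) by (auto simp: inj_on_def inj_def)
    qed (use return_lower[OF b(1) _ _ t] s p p_eq in auto)
  next
    assume p_eq: "p = (Minus, upper b s, pt t (1 - t))"
    show ?thesis unfolding p_eq
    proof (rule rotation_no_return[OF _ _ b(1) zero_less_one irr(2) _ n,
          where P = "\<lambda>s. 0 < s \<and> s < 1 + b \<and> regular (rect_tri b) (Minus, upper b s, pt t (1 - t))"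
            and g = "\<lambda>s. (Minus, upper b s, pt t (1 - t))" and s = s])
      show "inj_on (\<lambda>s. (Minus, upper b s, pt t (1 - t)))
        {s. 0 < s \<and> s < 1 + b \<and> regular (rect_tri b) (Minus, upper b s, pt t (1 - t))}"
        using inj(2) by (auto simp: inj_on_def inj_def)
    qed (use return_upper[OF b(1) _ _ t] s p p_eq in auto)
  qed
qed

text \<open>Iterates commute, so a periodic state would pass its period on to the state of its orbit
  that lies in the section.\<close>

lemma rect_tri_aperiodic:
  assumes b: "b > 0" "b \<notin> \<rat>" and p: "p \<in> phase_space (rect_tri b)" and n: "n \<ge> 1"
  shows "(billiard_map (rect_tri b) ^^ n) p \<noteq> p"
proof
  let ?\<phi> = "billiard_map (rect_tri b)"
  assume per: "(?\<phi> ^^ n) p = p"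
  obtain sg x y where p_eq: "p = (sg, x, y)" by (cases p)
  have "reaches_section b p"
    using P_max_reaches_section[OF b(1)] phase_space_regular p unfolding p_eq by blast
  then obtain k where k: "in_section b ((?\<phi> ^^ k) p)" "regular (rect_tri b) ((?\<phi> ^^ k) p)"
    using phase_space_regular(2) p unfolding p_eq reaches_section_def by blast
  have "(?\<phi> ^^ n) ((?\<phi> ^^ k) p) = (?\<phi> ^^ k) ((?\<phi> ^^ n) p)"
    by (simp add: add.commute flip: funpow_add o_apply[of "_ ^^ _" "_ ^^ _"])
  then show False using section_no_return[OF b k n] per by simp
qed

theorem theorem1p4:
  "\<exists>Q :: polygon_pair. convex_polygon (Q Minus) \<and> convex_polygon (Q Plus) \<and>
     \<not> (\<exists>p \<in> phase_space Q. \<exists>n::nat. n \<ge> 1 \<and> (billiard_map Q ^^ n) p = p)"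
proof -
  have "uncountable ({0<..<1} - \<rat> :: real set)"
    by (intro uncountable_minus_countable countable_rat) (simp add: uncountable_open_interval)
  then have "{0<..<1} - \<rat> \<noteq> ({} :: real set)" by (metis countable_empty)
  then obtain b :: real where "b \<in> {0<..<1} - \<rat>" by blast
  then have b: "b > 0" "b \<notin> \<rat>" by auto
  show ?thesis
    using convex_polygon_rect[OF b(1)] convex_polygon_tri rect_tri_aperiodic[OF b]
    by (intro exI[of _ "rect_tri b"]) auto
qed

end
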